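(* For every positive integer $m$ there are a finite alphabet $\Sigma$, a sentence $\varphi_m\in\mathrm{FO}^2_m[<,\mathrm{suc}]$ and two languages $K_m,L_m\subseteq\Sigma^\star$ such that $\varphi_m$ separates $K_m$ and $L_m$, but no sentence $\psi\in\mathrm{FO}^2_{m-1}[<,\mathrm{suc}]$ separates $K_m$ and $L_m$.
   Context: Words are finite structures with universe $\{1,\dots,|w|\}$, unary predicates $Q_a$ ($a\in\Sigma$) marking positions carrying $a$, the order $<$ and the successor relation $\mathrm{suc}(z,z')\iff z'=z+1$. $\mathrm{FO}^2_n[<,\mathrm{suc}]$ is first-order logic over this signature using only the variables $x,y$ with quantifier depth at most $n$; $\mathrm{FO}^2_{m,n}[<,\mathrm{suc}]$ is the set of its formulas in which every path in the parse tree has at most $m$ blocks of alternating quantifiers, and $\mathrm{FO}^2_m[<,\mathrm{suc}]=\bigcup_{n\ge m}\mathrm{FO}^2_{m,n}[<,\mathrm{suc}]$. A formula $\varphi$ separates $K,L$ if every word of $K$ satisfies $\varphi$ and no word of $L$ does, or vice versa. *)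

theory Defs
  imports Main
begin

text \<open>Two-variable first-order logic over words, signature Q_a, <, suc (and =).
  Formulas are in negation normal form: negation only in front of atoms.\<close>

datatype var = VX | VY

datatype 'a fo2 =
    TT | FF
  | Lett 'a var | NLett 'a var
  | Less var var | NLess var var
  | Succ var var | NSucc var var
  | Eq var var | NEq var var
  | And "'a fo2" "'a fo2" | Or "'a fo2" "'a fo2"
  | Ex var "'a fo2" | All var "'a fo2"

text \<open>Words are lists; positions are 0..<length w (universe {1..|w|} shifted).\<close>
fun sat :: "'a list \<Rightarrow> (var \<Rightarrow> nat) \<Rightarrow> 'a fo2 \<Rightarrow> bool" where
  "sat w s TT = True"
| "sat w s FF = False"
| "sat w s (Lett a v) = (w ! s v = a)"
| "sat w s (NLett a v) = (\<not> (w ! s v = a))"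
| "sat w s (Less u v) = (s u < s v)"
| "sat w s (NLess u v) = (\<not> s u < s v)"
| "sat w s (Succ u v) = (s v = s u + 1)"
| "sat w s (NSucc u v) = (\<not> s v = s u + 1)"
| "sat w s (Eq u v) = (s u = s v)"
| "sat w s (NEq u v) = (s u \<noteq> s v)"
| "sat w s (And \<phi> \<psi>) = (sat w s \<phi> \<and> sat w s \<psi>)"
| "sat w s (Or \<phi> \<psi>) = (sat w s \<phi> \<or> sat w s \<psi>)"
| "sat w s (Ex v \<phi>) = (\<exists>i<length w. sat w (s(v := i)) \<phi>)"
| "sat w s (All v \<phi>) = (\<forall>i<length w. sat w (s(v := i)) \<phi>)"

fun free :: "'a fo2 \<Rightarrow> var set" where
  "free TT = {}"
| "free FF = {}"
| "free (Lett a v) = {v}"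
| "free (NLett a v) = {v}"
| "free (Less u v) = {u, v}"
| "free (NLess u v) = {u, v}"
| "free (Succ u v) = {u, v}"
| "free (NSucc u v) = {u, v}"
| "free (Eq u v) = {u, v}"
| "free (NEq u v) = {u, v}"
| "free (And \<phi> \<psi>) = free \<phi> \<union> free \<psi>"
| "free (Or \<phi> \<psi>) = free \<phi> \<union> free \<psi>"
| "free (Ex v \<phi>) = free \<phi> - {v}"
| "free (All v \<phi>) = free \<phi> - {v}"

definition sentence :: "'a fo2 \<Rightarrow> bool" where
  "sentence \<phi> \<longleftrightarrow> free \<phi> = {}"

fun letters :: "'a fo2 \<Rightarrow> 'a set" where
  "letters (Lett a v) = {a}"
| "letters (NLett a v) = {a}"
| "letters (And \<phi> \<psi>) = letters \<phi> \<union> letters \<psi>"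
| "letters (Or \<phi> \<psi>) = letters \<phi> \<union> letters \<psi>"
| "letters (Ex v \<phi>) = letters \<phi>"
| "letters (All v \<phi>) = letters \<phi>"
| "letters _ = {}"

fun qdepth :: "'a fo2 \<Rightarrow> nat" where
  "qdepth (And \<phi> \<psi>) = max (qdepth \<phi>) (qdepth \<psi>)"
| "qdepth (Or \<phi> \<psi>) = max (qdepth \<phi>) (qdepth \<psi>)"
| "qdepth (Ex v \<phi>) = Suc (qdepth \<phi>)"
| "qdepth (All v \<phi>) = Suc (qdepth \<phi>)"
| "qdepth _ = 0"

text \<open>Maximal number of blocks of alternating quantifiers along a path of the
  parse tree; the argument records the kind of the last quantifier above
  (None: none, Some True: existential, Some False: universal).\<close>
fun blk :: "bool option \<Rightarrow> 'a fo2 \<Rightarrow> nat" where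
  "blk p (And \<phi> \<psi>) = max (blk p \<phi>) (blk p \<psi>)"
| "blk p (Or \<phi> \<psi>) = max (blk p \<phi>) (blk p \<psi>)"
| "blk p (Ex v \<phi>) = (if p = Some True then 0 else 1) + blk (Some True) \<phi>"
| "blk p (All v \<phi>) = (if p = Some False then 0 else 1) + blk (Some False) \<phi>"
| "blk p _ = 0"

definition blocks :: "'a fo2 \<Rightarrow> nat" where
  "blocks \<phi> = blk None \<phi>"

definition FO2mn :: "nat \<Rightarrow> nat \<Rightarrow> 'a fo2 set" where
  "FO2mn m n = {\<phi>. blocks \<phi> \<le> m \<and> qdepth \<phi> \<le> n}"

definition FO2m :: "nat \<Rightarrow> 'a fo2 set" where
  "FO2m m = (\<Union>n\<in>{m..}. FO2mn m n)"

definition separates :: "'a fo2 \<Rightarrow> 'a list set \<Rightarrow> 'a list set \<Rightarrow> bool" where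
  "separates \<phi> K L \<longleftrightarrow>
     ((\<forall>w\<in>K. sat w (\<lambda>_. 0) \<phi>) \<and> (\<forall>w\<in>L. \<not> sat w (\<lambda>_. 0) \<phi>)) \<or>
     ((\<forall>w\<in>L. sat w (\<lambda>_. 0) \<phi>) \<and> (\<forall>w\<in>K. \<not> sat w (\<lambda>_. 0) \<phi>))"

end

theory Submission
  imports Defs
begin

text \<open>
  The words are built by induction on the number \<open>m\<close> of blocks. Words \<open>u\<close>, \<open>v\<close> that agree on all
  sentences with \<open>m\<close> blocks are inserted between contexts \<open>C = \<dots> s x s x\<close> and \<open>D = y s y s \<dots>\<close>,
  where \<open>s\<close> lists all letters of \<open>u\<close> and \<open>v\<close>, and \<open>x\<close>, \<open>y\<close> are new. Within a single block of bounded
  depth, two positions of the inserted words with the same letter look alike, because any letter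
  sought from there also occurs in the nearby context. Hence the last block is wasted, and
  \<open>C u D\<close>, \<open>C v D\<close> agree on sentences with \<open>m + 1\<close> blocks. On the other hand, the inserted positions
  are those with no \<open>x\<close> at or to the right and no \<open>y\<close> at or to the left, so relativizing a separating
  sentence to them costs one block. The induction starts with the words \<open>0 0\<close> and \<open>0\<close>. All this uses
  the order only; finally, surrounding every letter by long stretches of a filler letter makes the
  successor relation useless.
\<close>

section \<open>Negation and relativization\<close>

fun neg :: "'a fo2 \<Rightarrow> 'a fo2" where
  "neg TT = FF"
| "neg FF = TT"
| "neg (Lett a v) = NLett a v"
| "neg (NLett a v) = Lett a v"
| "neg (Less u v) = NLess u v"
| "neg (NLess u v) = Less u v"
| "neg (Succ u v) = NSucc u v"
| "neg (NSucc u v) = Succ u v"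
| "neg (Eq u v) = NEq u v"
| "neg (NEq u v) = Eq u v"
| "neg (And \<phi> \<psi>) = Or (neg \<phi>) (neg \<psi>)"
| "neg (Or \<phi> \<psi>) = And (neg \<phi>) (neg \<psi>)"
| "neg (Ex v \<phi>) = All v (neg \<phi>)"
| "neg (All v \<phi>) = Ex v (neg \<phi>)"

lemma sat_neg [simp]: "sat w s (neg \<phi>) \<longleftrightarrow> \<not> sat w s \<phi>"
  by (induction \<phi> arbitrary: s) auto

lemma free_neg [simp]: "free (neg \<phi>) = free \<phi>"
  by (induction \<phi>) auto

lemma letters_neg [simp]: "letters (neg \<phi>) = letters \<phi>"
  by (induction \<phi>) auto

lemma qdepth_neg [simp]: "qdepth (neg \<phi>) = qdepth \<phi>"
  by (induction \<phi>) auto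

lemma size_neg [simp]: "size (neg \<phi>) = size \<phi>"
  by (induction \<phi>) auto

lemma blk_neg [simp]: "blk p (neg \<phi>) = blk (map_option Not p) \<phi>"
  by (induction \<phi> arbitrary: p) (auto simp: map_option_case split: option.splits)

fun suc_free :: "'a fo2 \<Rightarrow> bool" where
  "suc_free (Succ u v) = False"
| "suc_free (NSucc u v) = False"
| "suc_free (And \<phi> \<psi>) = (suc_free \<phi> \<and> suc_free \<psi>)"
| "suc_free (Or \<phi> \<psi>) = (suc_free \<phi> \<and> suc_free \<psi>)"
| "suc_free (Ex v \<phi>) = suc_free \<phi>"
| "suc_free (All v \<phi>) = suc_free \<phi>"
| "suc_free \<phi> = True"

lemma suc_free_neg [simp]: "suc_free (neg \<phi>) = suc_free \<phi>"
  by (induction \<phi>) auto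

fun relativize :: "(var \<Rightarrow> 'a fo2) \<Rightarrow> 'a fo2 \<Rightarrow> 'a fo2" where
  "relativize G (And \<phi> \<psi>) = And (relativize G \<phi>) (relativize G \<psi>)"
| "relativize G (Or \<phi> \<psi>) = Or (relativize G \<phi>) (relativize G \<psi>)"
| "relativize G (Ex v \<phi>) = Ex v (And (G v) (relativize G \<phi>))"
| "relativize G (All v \<phi>) = All v (Or (neg (G v)) (relativize G \<phi>))"
| "relativize G \<phi> = \<phi>"

lemma free_relativize: "(\<And>v. free (G v) \<subseteq> {v}) \<Longrightarrow> free (relativize G \<phi>) \<subseteq> free \<phi>"
  by (induction \<phi>) fastforce+

lemma letters_relativize:
  "(\<And>v. letters (G v) \<subseteq> A) \<Longrightarrow> letters \<phi> \<subseteq> A \<Longrightarrow> letters (relativize G \<phi>) \<subseteq> A"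
  by (induction \<phi>) auto

lemma suc_free_relativize: "(\<And>v. suc_free (G v)) \<Longrightarrow> suc_free \<phi> \<Longrightarrow> suc_free (relativize G \<phi>)"
  by (induction \<phi>) auto

lemma blk_relativize:
  assumes "\<And>v. blk (Some True) (G v) \<le> d"
  shows "blk p (relativize G \<phi>) \<le> blk p \<phi> + d"
proof (induction \<phi> arbitrary: p)
  case (And \<phi> \<psi>)
  show ?case using And.IH(1)[of p] And.IH(2)[of p] by (auto simp: max_def)
next
  case (Or \<phi> \<psi>)
  show ?case using Or.IH(1)[of p] Or.IH(2)[of p] by (auto simp: max_def)
qed (auto simp: trans_le_add2 assms)

definition guarded_embedding :: "(var \<Rightarrow> 'a fo2) \<Rightarrow> (nat \<Rightarrow> nat) \<Rightarrow> 'a list \<Rightarrow> 'a list \<Rightarrow> bool" where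
  "guarded_embedding G e w w' \<longleftrightarrow>
     strict_mono_on {..<length w} e \<and>
     (\<forall>i<length w. e i < length w' \<and> w' ! e i = w ! i) \<and>
     (\<forall>s v. s v < length w' \<longrightarrow> (sat w' s (G v) \<longleftrightarrow> s v \<in> e ` {..<length w}))"

lemma sat_relativize_quantifier:
  assumes embedding: "guarded_embedding G e w w'"
  shows "sat w' s (relativize G (Ex v \<phi>)) \<longleftrightarrow>
      (\<exists>i<length w. sat w' (s(v := e i)) (relativize G \<phi>))"
    and "sat w' s (relativize G (All v \<phi>)) \<longleftrightarrow>
      (\<forall>i<length w. sat w' (s(v := e i)) (relativize G \<phi>))"
proof -
  have guard: "sat w' (s(v := p)) (G v) \<longleftrightarrow> p \<in> e ` {..<length w}" if "p < length w'" for p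
    using embedding that by (simp add: guarded_embedding_def)
  have range: "e i < length w'" if "i < length w" for i
    using embedding that by (simp add: guarded_embedding_def)
  show "sat w' s (relativize G (Ex v \<phi>)) \<longleftrightarrow>
      (\<exists>i<length w. sat w' (s(v := e i)) (relativize G \<phi>))"
    using guard range by auto
  show "sat w' s (relativize G (All v \<phi>)) \<longleftrightarrow>
      (\<forall>i<length w. sat w' (s(v := e i)) (relativize G \<phi>))"
    using guard range by auto
qed

lemma sat_relativize:
  assumes embedding: "guarded_embedding G e w w'" and "suc_free \<phi>" "\<And>v. s v < length w"
  shows "sat w' (e \<circ> s) (relativize G \<phi>) \<longleftrightarrow> sat w s \<phi>"
  using assms(2,3)
proof (induction \<phi> arbitrary: s)
  case (Ex v \<phi>)
  have "sat w' ((e \<circ> s)(v := e i)) (relativize G \<phi>) \<longleftrightarrow> sat w (s(v := i)) \<phi>" if "i < length w" for i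
    unfolding fun_upd_comp[symmetric] by (rule Ex.IH) (use Ex.prems that in simp_all)
  then show ?case unfolding sat_relativize_quantifier(1)[OF embedding] by auto
next
  case (All v \<phi>)
  have "sat w' ((e \<circ> s)(v := e i)) (relativize G \<phi>) \<longleftrightarrow> sat w (s(v := i)) \<phi>" if "i < length w" for i
    unfolding fun_upd_comp[symmetric] by (rule All.IH) (use All.prems that in simp_all)
  then show ?case unfolding sat_relativize_quantifier(2)[OF embedding] by auto
qed (use embedding strict_mono_on_less[of "{..<length w}" e] strict_mono_on_eq[of "{..<length w}" e]
    in \<open>simp_all add: guarded_embedding_def\<close>)

lemma sat_cong_free: "(\<And>v. v \<in> free \<phi> \<Longrightarrow> s v = s' v) \<Longrightarrow> sat w s \<phi> \<longleftrightarrow> sat w s' \<phi>"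
proof (induction \<phi> arbitrary: s s')
  case (And \<phi> \<psi>)
  have "sat w s \<phi> \<longleftrightarrow> sat w s' \<phi>" by (rule And.IH(1)) (use And.prems in simp)
  moreover have "sat w s \<psi> \<longleftrightarrow> sat w s' \<psi>" by (rule And.IH(2)) (use And.prems in simp)
  ultimately show ?case by simp
next
  case (Or \<phi> \<psi>)
  have "sat w s \<phi> \<longleftrightarrow> sat w s' \<phi>" by (rule Or.IH(1)) (use Or.prems in simp)
  moreover have "sat w s \<psi> \<longleftrightarrow> sat w s' \<psi>" by (rule Or.IH(2)) (use Or.prems in simp)
  ultimately show ?case by simp
next
  case (Ex v \<phi>)
  have "sat w (s(v := i)) \<phi> \<longleftrightarrow> sat w (s'(v := i)) \<phi>" for i
    by (rule Ex.IH) (use Ex.prems in simp)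
  then show ?case by simp
next
  case (All v \<phi>)
  have "sat w (s(v := i)) \<phi> \<longleftrightarrow> sat w (s'(v := i)) \<phi>" for i
    by (rule All.IH) (use All.prems in simp)
  then show ?case by simp
qed simp_all

lemma sat_sentence_cong: "sentence \<phi> \<Longrightarrow> sat w s \<phi> \<longleftrightarrow> sat w s' \<phi>"
  by (rule sat_cong_free) (simp add: sentence_def)

section \<open>One-sided games\<close>

definition capped_diff :: "nat \<Rightarrow> nat \<Rightarrow> nat \<Rightarrow> int" where
  "capped_diff t i j = max (- int t) (min (int t) (int j - int i))"

lemma capped_diff_self [simp]: "capped_diff t i i = 0"
  by (simp add: capped_diff_def)

lemma capped_diff_swap: "capped_diff t j i = - capped_diff t i j"
  unfolding capped_diff_def by linarith

lemma capped_diff_1: "capped_diff 1 i j = sgn (int j - int i)"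
  by (auto simp: capped_diff_def sgn_if)

lemma capped_diff_far: "\<bar>\<sigma>\<bar> = 1 \<Longrightarrow> int t \<le> \<sigma> * (int j - int i) \<Longrightarrow> capped_diff t i j = int t * \<sigma>"
  by (auto simp: capped_diff_def abs_if split: if_splits)

text \<open>Spoiler has \<open>n\<close> moves in at most \<open>m\<close> blocks: he moves in the first word, and exchanging the
  words opens a new block. A move reveals the distance to the previous position up to the cap \<open>t\<close>,
  that is, the order for \<open>t = 1\<close>, and the order and the successor relation for \<open>t = 2\<close>.\<close>

fun game :: "nat \<Rightarrow> nat \<Rightarrow> nat \<Rightarrow> 'a list \<Rightarrow> nat \<Rightarrow> 'a list \<Rightarrow> nat \<Rightarrow> bool" where
  "game t 0 n w i w' j \<longleftrightarrow> w ! i = w' ! j"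
| "game t (Suc m) 0 w i w' j \<longleftrightarrow> w ! i = w' ! j"
| "game t (Suc m) (Suc n) w i w' j \<longleftrightarrow> game t m (Suc n) w' j w i \<and>
     (\<forall>i'<length w. \<exists>j'<length w'.
        capped_diff t i i' = capped_diff t j j' \<and> game t (Suc m) n w i' w' j')"

lemma game_imp_nth_eq: "game t m n w i w' j \<Longrightarrow> w ! i = w' ! j"
  by (induction t m n w i w' j rule: game.induct) auto

lemma game_no_moves: "game t m 0 w i w' j \<longleftrightarrow> w ! i = w' ! j"
  by (cases m) auto

lemma game_swap: "game t (Suc m) n w i w' j \<Longrightarrow> game t m n w' j w i"
  by (cases n) (auto simp: game_no_moves)

lemma game_forth:
  assumes "game t (Suc m) (Suc n) w i w' j" "i' < length w"
  obtains j' where "j' < length w'" "capped_diff t i i' = capped_diff t j j'"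
    "game t (Suc m) n w i' w' j'"
  using assms by auto

lemma game_mono:
  "game t m n w i w' j \<Longrightarrow> m' \<le> m \<Longrightarrow> n' \<le> n \<Longrightarrow> game t m' n' w i w' j"
proof (induction t m' n' w i w' j arbitrary: m n
    rule: game.induct[case_names no_blocks no_moves move])
  case (move t m' n' w i w' j)
  then obtain k l where "m = Suc k" "n = Suc l" by (meson Suc_le_D)
  then have game: "game t (Suc k) (Suc l) w i w' j" and bounds: "m' \<le> k" "n' \<le> l"
    using move.prems by simp_all
  have "game t m' (Suc n') w' j w i"
    by (rule move.IH(1)[OF game_swap[OF game]]) (use bounds in simp_all)
  moreover have "\<exists>j'<length w'. capped_diff t i i' = capped_diff t j j' \<and>
      game t (Suc m') n' w i' w' j'" if "i' < length w" for i'
    using game_forth[OF game that] move.IH(2) that bounds by (metis Suc_le_mono)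
  ultimately show ?case by simp
qed (simp_all add: game_imp_nth_eq)

lemmas game_Suc_depth = game_mono[OF _ le_refl le_SucI[OF le_refl]]

lemma game_first:
  assumes "game t (Suc m) (Suc n) w i w' 0" "i < length w" "0 < t"
  shows "i = 0"
proof (rule ccontr)
  assume "i \<noteq> 0"
  moreover have "0 < length w" using assms(2) by linarith
  with assms(1) obtain j' where "capped_diff t i 0 = capped_diff t 0 j'" by (rule game_forth)
  ultimately show False
    using assms(3) by (simp add: capped_diff_def min_def max_def split: if_splits)
qed

lemma game_last:
  assumes "game t (Suc m) (Suc n) w i w' j" "i < length w" "Suc j = length w'" "0 < t"
  shows "Suc i = length w"
proof (rule ccontr)
  assume "Suc i \<noteq> length w"
  then have "Suc i < length w" using assms(2) by simp
  with assms(1) obtain j' where "j' < length w'" "capped_diff t i (Suc i) = capped_diff t j j'"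
    by (rule game_forth)
  then show False
    using assms(3,4) by (simp add: capped_diff_def min_def max_def split: if_splits)
qed

definition game_equiv :: "nat \<Rightarrow> nat \<Rightarrow> nat \<Rightarrow> 'a list \<Rightarrow> 'a list \<Rightarrow> bool" where
  "game_equiv t m n w w' \<longleftrightarrow>
     (\<forall>i<length w. \<exists>j<length w'. game t m n w i w' j) \<and>
     (\<forall>j<length w'. \<exists>i<length w. game t m n w' j w i)"

lemma game_equiv_sym: "game_equiv t m n w w' \<Longrightarrow> game_equiv t m n w' w"
  by (auto simp: game_equiv_def)

lemma game_equiv_forth:
  assumes "game_equiv t m n w w'" "i < length w"
  obtains j where "j < length w'" "game t m n w i w' j"
  using assms by (auto simp: game_equiv_def)

lemma game_equiv_mono:
  "game_equiv t m n w w' \<Longrightarrow> m' \<le> m \<Longrightarrow> n' \<le> n \<Longrightarrow> game_equiv t m' n' w w'"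
  unfolding game_equiv_def using game_mono by blast

lemma game_equiv_imp_set_eq:
  assumes "game_equiv t m n w w'"
  shows "set w = set w'"
proof -
  have "set u \<subseteq> set u'" if equiv: "game_equiv t m n u u'" for u u' :: "'a list"
  proof
    fix a assume "a \<in> set u"
    then obtain i where nth_i: "i < length u" "u ! i = a" by (meson in_set_conv_nth)
    obtain j where "j < length u'" "game t m n u i u' j"
      using equiv nth_i(1) by (rule game_equiv_forth)
    then show "a \<in> set u'" using game_imp_nth_eq nth_i(2) nth_mem by metis
  qed
  then show ?thesis using assms game_equiv_sym by blast
qed

section \<open>From games to sentences\<close>

fun other :: "var \<Rightarrow> var" where
  "other VX = VY"
| "other VY = VX"

lemma other_neq [simp]: "other v \<noteq> v" "v \<noteq> other v"
  by (cases v; simp)+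

lemma eq_or_eq_other: "u = v \<or> u = other v"
  by (cases u; cases v; simp)

definition matched ::
  "nat \<Rightarrow> nat \<Rightarrow> 'a list \<Rightarrow> (var \<Rightarrow> nat) \<Rightarrow> 'a list \<Rightarrow> (var \<Rightarrow> nat) \<Rightarrow> bool" where
  "matched m n w s w' s' \<longleftrightarrow>
     (\<forall>v. s v < length w \<and> s' v < length w' \<and> game 2 m n w (s v) w' (s' v)) \<and>
     (\<forall>u v. capped_diff 2 (s u) (s v) = capped_diff 2 (s' u) (s' v))"

lemma matched_swap: "matched (Suc m) n w s w' s' \<Longrightarrow> matched m n w' s' w s"
  by (simp add: matched_def game_swap)

lemma matched_forth:
  assumes matched: "matched (Suc m) (Suc n) w s w' s'" and i_less: "i < length w"
  obtains j where "j < length w'" "matched (Suc m) n w (s(v := i)) w' (s'(v := j))"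
proof -
  let ?o = "other v"
  have "game 2 (Suc m) (Suc n) w (s ?o) w' (s' ?o)" using matched by (simp add: matched_def)
  then obtain j where reply: "j < length w'" "capped_diff 2 (s ?o) i = capped_diff 2 (s' ?o) j"
      "game 2 (Suc m) n w i w' j"
    using i_less by (rule game_forth)
  have "capped_diff 2 ((s(v := i)) x) ((s(v := i)) y) =
      capped_diff 2 ((s'(v := j)) x) ((s'(v := j)) y)" for x y
    using eq_or_eq_other[of x v] eq_or_eq_other[of y v] reply(2) matched
    unfolding matched_def
    by (auto simp: capped_diff_swap[of 2 i] capped_diff_swap[of 2 j])
  moreover have "game 2 (Suc m) n w (s x) w' (s' x)" for x
    using matched game_Suc_depth unfolding matched_def by blast
  ultimately have "matched (Suc m) n w (s(v := i)) w' (s'(v := j))"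
    using matched i_less reply(1,3) by (simp add: matched_def)
  with reply(1) show thesis by (rule that)
qed

lemma matched_atoms:
  assumes "matched m n w s w' s'"
  shows "w ! s v = w' ! s' v" "s u < s v \<longleftrightarrow> s' u < s' v" "s u = s v \<longleftrightarrow> s' u = s' v"
    "s v = Suc (s u) \<longleftrightarrow> s' v = Suc (s' u)"
proof -
  show "w ! s v = w' ! s' v" using assms game_imp_nth_eq unfolding matched_def by blast
  have "capped_diff 2 (s u) (s v) = capped_diff 2 (s' u) (s' v)"
    using assms by (simp add: matched_def)
  then show "s u < s v \<longleftrightarrow> s' u < s' v" "s u = s v \<longleftrightarrow> s' u = s' v"
    "s v = Suc (s u) \<longleftrightarrow> s' v = Suc (s' u)"
    unfolding capped_diff_def by linarith+
qed

lemma matched_imp_sat: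
  assumes "matched (Suc m) n w s w' s'" "qdepth \<phi> \<le> n" "blk (Some True) \<phi> \<le> m" "sat w s \<phi>"
  shows "sat w' s' \<phi>"
  using assms
proof (induction "size \<phi>" arbitrary: \<phi> m n w s w' s' rule: less_induct)
  case less
  show ?case
  proof (cases \<phi>)
    case (And \<psi> \<chi>)
    have "sat w s \<psi> \<Longrightarrow> sat w' s' \<psi>" "sat w s \<chi> \<Longrightarrow> sat w' s' \<chi>"
      by (rule less.hyps[OF _ less.prems(1)]; use And less.prems(2,3) in simp)+
    then show ?thesis using And less.prems(4) by auto
  next
    case (Or \<psi> \<chi>)
    have "sat w s \<psi> \<Longrightarrow> sat w' s' \<psi>" "sat w s \<chi> \<Longrightarrow> sat w' s' \<chi>"
      by (rule less.hyps[OF _ less.prems(1)]; use Or less.prems(2,3) in simp)+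
    then show ?thesis using Or less.prems(4) by auto
  next
    case (Ex v \<psi>)
    obtain n' where n_eq: "n = Suc n'" using Ex less.prems(2) by (cases n) auto
    obtain i where witness: "i < length w" "sat w (s(v := i)) \<psi>" using Ex less.prems(4) by auto
    obtain j where reply: "j < length w'" "matched (Suc m) n' w (s(v := i)) w' (s'(v := j))"
      using less.prems(1) witness(1) unfolding n_eq by (rule matched_forth)
    have "sat w' (s'(v := j)) \<psi>"
      using less.hyps[OF _ reply(2) _ _ witness(2)] Ex less.prems(2,3) n_eq by simp
    then show ?thesis using Ex reply(1) by auto
  next
    case (All v \<psi>)
    obtain n' where n_eq: "n = Suc n'" using All less.prems(2) by (cases n) auto
    obtain m' where m_eq: "m = Suc m'" using All less.prems(3) by (cases m) auto
    have "sat w' (s'(v := j)) \<psi>" if j_less: "j < length w'" for j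
    proof (rule ccontr)
      assume "\<not> sat w' (s'(v := j)) \<psi>"
      then have not_sat: "sat w' (s'(v := j)) (neg \<psi>)" by simp
      obtain i where reply: "i < length w" "matched (Suc m') n' w' (s'(v := j)) w (s(v := i))"
        using matched_swap[OF less.prems(1)] j_less unfolding n_eq m_eq by (rule matched_forth)
      have "sat w (s(v := i)) (neg \<psi>)"
        using less.hyps[OF _ reply(2) _ _ not_sat] All less.prems(2,3) n_eq m_eq by simp
      then show False using All less.prems(4) reply(1) by simp
    qed
    then show ?thesis using All by simp
  qed (use less.prems(4) matched_atoms[OF less.prems(1)] in \<open>metis sat.simps(1-10) Suc_eq_plus1\<close>)+
qed

lemma game_equiv_imp_sat:
  assumes "game_equiv 2 (Suc m) n w w'" "sentence \<phi>" "qdepth \<phi> \<le> n" "blk (Some True) \<phi> \<le> m"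
    and "sat w s \<phi>"
  shows "sat w' s' \<phi>"
proof (cases "w = []")
  case True
  then have "w' = w" using game_equiv_imp_set_eq[OF assms(1)] by simp
  then show ?thesis using assms(5) sat_sentence_cong[OF assms(2)] by blast
next
  case False
  then obtain j where "j < length w'" "game 2 (Suc m) n w 0 w' j"
    using game_equiv_forth[OF assms(1)] by blast
  with False have "matched (Suc m) n w (\<lambda>_. 0) w' (\<lambda>_. j)" by (simp add: matched_def)
  from matched_imp_sat[OF this assms(3,4)] show ?thesis
    using assms(5) sat_sentence_cong[OF assms(2)] by blast
qed

lemma game_equiv_sat_iff:
  assumes equiv: "game_equiv 2 m n w w'"
    and "sentence \<phi>" "qdepth \<phi> \<le> n" "blocks \<phi> \<le> m"
  shows "sat w s \<phi> \<longleftrightarrow> sat w' s' \<phi>"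
  using assms(2-)
proof (induction \<phi>)
  case (Ex v \<phi>)
  obtain k where m_eq: "m = Suc k" using Ex.prems(3) by (cases m) (auto simp: blocks_def)
  have "blk (Some True) (Ex v \<phi>) \<le> k" using Ex.prems(3) m_eq by (simp add: blocks_def)
  from game_equiv_imp_sat[OF _ Ex.prems(1,2) this] show ?case
    using equiv game_equiv_sym unfolding m_eq by blast
next
  case (All v \<phi>)
  let ?\<psi> = "neg (All v \<phi>)"
  obtain k where m_eq: "m = Suc k" using All.prems(3) by (cases m) (auto simp: blocks_def)
  have "sentence ?\<psi>" "qdepth ?\<psi> \<le> n" "blk (Some True) ?\<psi> \<le> k"
    using All.prems m_eq by (auto simp: blocks_def sentence_def simp del: neg.simps)
  from game_equiv_imp_sat[OF _ this] have "sat w s ?\<psi> \<longleftrightarrow> sat w' s' ?\<psi>"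
    using equiv game_equiv_sym unfolding m_eq by blast
  then show ?case by (simp only: sat_neg) blast
qed (auto simp: sentence_def blocks_def)

section \<open>Sandwiching words between recurrent contexts\<close>

definition recurrent :: "nat \<Rightarrow> 'a list \<Rightarrow> bool" where
  "recurrent P xs \<longleftrightarrow> (\<forall>p. \<forall>a\<in>set xs. p + P \<le> length xs \<longrightarrow> (\<exists>q\<in>{p..<p + P}. xs ! q = a))"

lemma length_concat_equal_length:
  "\<forall>xs\<in>set xss. length xs = k \<Longrightarrow> length (concat xss) = k * length xss"
  by (induction xss) auto

lemma nth_concat_equal_length:
  "\<forall>xs\<in>set xss. length xs = k \<Longrightarrow> p < k * length xss \<Longrightarrow>
    concat xss ! p = xss ! (p div k) ! (p mod k)"
proof (induction xss arbitrary: p)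
  case (Cons xs xss)
  show ?case
  proof (cases "p < k")
    case True
    then show ?thesis using Cons.prems by (simp add: nth_append)
  next
    case False
    then have "k > 0" using Cons.prems(2) by (cases k) auto
    then have "p div k = Suc ((p - k) div k)" "p mod k = (p - k) mod k"
      using False by (simp_all add: le_div_geq le_mod_geq)
    moreover have "concat xss ! (p - k) = xss ! ((p - k) div k) ! ((p - k) mod k)"
      using Cons.prems False by (intro Cons.IH) auto
    ultimately show ?thesis using Cons.prems(1) False by (simp add: nth_append)
  qed
qed simp

lemma ex_mod_eq_in_window:
  fixes P r p :: nat
  assumes "r < P"
  shows "\<exists>q\<in>{p..<p + P}. q mod P = r"
proof
  let ?shift = "(int r - int p) mod int P"
  have shift: "0 \<le> ?shift" "?shift < int P" using assms by simp_all
  then show "p + nat ?shift \<in> {p..<p + P}" by auto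
  have "int ((p + nat ?shift) mod P) = (int p + ?shift) mod int P"
    using shift(1) by (simp add: zmod_int)
  also have "\<dots> = int r" using assms by (simp add: mod_add_right_eq)
  finally show "(p + nat ?shift) mod P = r" by simp
qed

lemma recurrent_concat_replicate: "recurrent (length xs) (concat (replicate N xs))"
  unfolding recurrent_def
proof (intro allI ballI impI)
  fix p a assume "a \<in> set (concat (replicate N xs))"
    and window: "p + length xs \<le> length (concat (replicate N xs))"
  then obtain r where index: "r < length xs" "xs ! r = a"
    by (auto simp: in_set_conv_nth split: if_splits)
  from index(1) obtain q where hit: "q \<in> {p..<p + length xs}" "q mod length xs = r"
    using ex_mod_eq_in_window by blast
  have "q < length xs * N"
    using hit(1) window length_concat_equal_length[of "replicate N xs" "length xs"] by auto
  moreover from this have "q div length xs < N"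
    by (simp add: less_mult_imp_div_less mult.commute)
  ultimately have "concat (replicate N xs) ! q = a"
    using nth_concat_equal_length[of "replicate N xs" "length xs" q] hit(2) index(2) by simp
  then show "\<exists>q\<in>{p..<p + length xs}. concat (replicate N xs) ! q = a" using hit(1) by blast
qed

locale recurrent_contexts =
  fixes C D :: "'a list" and P :: nat
  assumes recurrent_left: "recurrent P C" and recurrent_right: "recurrent P D"
begin

abbreviation sandwich :: "'a list \<Rightarrow> 'a list" where
  "sandwich u \<equiv> rev C @ u @ D"

text \<open>The left context is stored reversed, so that both contexts are read outwards from the
  inserted word. A single block of quantifiers cannot tell the inserted positions apart by what
  surrounds the inserted word, so they all share the coordinate \<open>0\<close>.\<close>

definition coord :: "'a list \<Rightarrow> nat \<Rightarrow> int" where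
  "coord u p =
     (if p < length C then int p - int (length C)
      else if p < length C + length u then 0
      else int p - int (length C + length u) + 1)"

definition side :: "int \<Rightarrow> 'a list" where
  "side \<sigma> = (if \<sigma> > 0 then D else C)"

lemma recurrent_side: "recurrent P (side \<sigma>)"
  using recurrent_left recurrent_right by (simp add: side_def)

lemma coord_mono: "p \<le> q \<Longrightarrow> coord u p \<le> coord u q"
  by (auto simp: coord_def)

lemma coord_eq_0_iff: "coord u p = 0 \<longleftrightarrow> length C \<le> p \<and> p < length C + length u"
  by (auto simp: coord_def)

lemma capped_diff_coord:
  "coord u i \<noteq> 0 \<or> coord u j \<noteq> 0 \<Longrightarrow> capped_diff 1 i j = sgn (coord u j - coord u i)"
  by (auto simp: coord_def capped_diff_def sgn_if split: if_splits)

lemma sandwich_middle: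
  assumes "a < length u"
  shows "length C + a < length (sandwich u)" "coord u (length C + a) = 0"
    "sandwich u ! (length C + a) = u ! a"
  using assms by (auto simp: coord_def nth_append)

lemma sandwich_nth_middle: "coord u p = 0 \<Longrightarrow> sandwich u ! p = u ! (p - length C)"
  by (auto simp: coord_eq_0_iff nth_append)

lemma sandwich_nth_side:
  assumes "coord u p \<noteq> 0" "p < length (sandwich u)"
  shows "nat \<bar>coord u p\<bar> - 1 < length (side (coord u p))"
    and "sandwich u ! p = side (coord u p) ! (nat \<bar>coord u p\<bar> - 1)"
proof -
  consider (left) "p < length C" | (right) "length C + length u \<le> p"
    using assms(1) by (fastforce simp: coord_eq_0_iff)
  then have "nat \<bar>coord u p\<bar> - 1 < length (side (coord u p)) \<and>
      sandwich u ! p = side (coord u p) ! (nat \<bar>coord u p\<bar> - 1)"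
  proof cases
    case left
    then show ?thesis
      by (simp add: coord_def side_def nth_append rev_nth nat_diff_distrib)
  next
    case right
    then obtain q where "p = length C + length u + q" using le_Suc_ex by blast
    then show ?thesis using assms(2)
      by (simp add: coord_def side_def nth_append nat_add_distrib)
  qed
  then show "nat \<bar>coord u p\<bar> - 1 < length (side (coord u p))"
    and "sandwich u ! p = side (coord u p) ! (nat \<bar>coord u p\<bar> - 1)" by blast+
qed

lemma coord_surj:
  assumes "\<alpha> \<noteq> 0" "\<bar>\<alpha>\<bar> \<le> int (length (side \<alpha>))"
  obtains p where "p < length (sandwich u)" "coord u p = \<alpha>"
proof (cases "\<alpha> > 0")
  case True
  with assms show thesis
    by (intro that[of "length C + length u + nat \<alpha> - 1"]) (auto simp: side_def coord_def)
next
  case False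
  with assms show thesis
    by (intro that[of "length C - nat (- \<alpha>)"]) (auto simp: side_def coord_def)
qed

lemma sandwich_nth_in_side:
  assumes "p < length (sandwich u)" "set u \<subseteq> set (side \<sigma>)" "0 \<le> \<sigma> * coord u p" "\<bar>\<sigma>\<bar> = 1"
  shows "sandwich u ! p \<in> set (side \<sigma>)"
proof (cases "coord u p = 0")
  case True
  then have "p - length C < length u" by (auto simp: coord_eq_0_iff)
  then show ?thesis using sandwich_nth_middle[OF True] assms(2) nth_mem by fastforce
next
  case False
  then have "side (coord u p) = side \<sigma>"
    using assms(3,4) by (auto simp: side_def abs_if split: if_splits)
  then show ?thesis using sandwich_nth_side[OF False assms(1)] by simp
qed

text \<open>Duplicator either copies the coordinate of Spoiler's position (aligned) or, while only one
  block is left, answers further out on side \<open>\<sigma>\<close>, where \<open>n\<close> moves outwards are still possible.\<close>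

definition aligned :: "nat \<Rightarrow> nat \<Rightarrow> 'a list \<Rightarrow> nat \<Rightarrow> 'a list \<Rightarrow> nat \<Rightarrow> bool" where
  "aligned m n u i v j \<longleftrightarrow> coord u i = coord v j \<and>
     (coord u i = 0 \<longrightarrow> game 1 m n u (i - length C) v (j - length C))"

definition drifted :: "int \<Rightarrow> nat \<Rightarrow> 'a list \<Rightarrow> nat \<Rightarrow> 'a list \<Rightarrow> nat \<Rightarrow> bool" where
  "drifted \<sigma> n u i v j \<longleftrightarrow> \<bar>\<sigma>\<bar> = 1 \<and> sandwich u ! i = sandwich v ! j \<and>
     0 \<le> \<sigma> * coord u i \<and> \<sigma> * coord u i < \<sigma> * coord v j \<and>
     \<sigma> * coord v j + int (n * P) \<le> int (length (side \<sigma>))"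

definition linked :: "nat \<Rightarrow> nat \<Rightarrow> 'a list \<Rightarrow> nat \<Rightarrow> 'a list \<Rightarrow> nat \<Rightarrow> bool" where
  "linked m n u i v j \<longleftrightarrow> i < length (sandwich u) \<and> j < length (sandwich v) \<and>
     (aligned m n u i v j \<or> m = 0 \<and> (\<exists>\<sigma>. drifted \<sigma> n u i v j))"

lemma linked_imp_nth_eq:
  assumes "linked m n u i v j"
  shows "sandwich u ! i = sandwich v ! j"
proof (cases "aligned m n u i v j")
  case True
  show ?thesis
  proof (cases "coord u i = 0")
    case True
    then have "u ! (i - length C) = v ! (j - length C)" "coord v j = 0"
      using \<open>aligned m n u i v j\<close> game_imp_nth_eq unfolding aligned_def by auto
    then show ?thesis using True sandwich_nth_middle by metis
  next
    case False
    then show ?thesis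
      using True assms sandwich_nth_side(2)[of u i] sandwich_nth_side(2)[of v j]
      unfolding aligned_def linked_def by simp
  qed
next
  case False
  then show ?thesis using assms unfolding linked_def drifted_def by blast
qed

lemma linked_swap: "linked (Suc m) n u i v j \<Longrightarrow> linked m n v j u i"
  unfolding linked_def aligned_def using game_swap by fastforce

lemma aligned_reply:
  assumes equiv: "game_equiv 1 m n u v" and i_less: "i < length (sandwich u)"
  obtains j where "j < length (sandwich v)" "aligned m n u i v j"
proof (cases "coord u i = 0")
  case True
  then have "i - length C < length u" by (auto simp: coord_eq_0_iff)
  with equiv obtain b where "b < length v" "game 1 m n u (i - length C) v b"
    by (rule game_equiv_forth)
  then show thesis
    using that[of "length C + b"] sandwich_middle[of b v] True by (simp add: aligned_def)
next
  case False
  with i_less have "\<bar>coord u i\<bar> \<le> int (length (side (coord u i)))"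
    using sandwich_nth_side(1)[of u i] by linarith
  with False obtain j where "j < length (sandwich v)" "coord v j = coord u i"
    by (rule coord_surj)
  with False show thesis using that by (simp add: aligned_def)
qed

lemma drifted_reply:
  assumes unit: "\<bar>\<sigma>\<bar> = 1" and letters: "set u \<subseteq> set (side \<sigma>)" and i_less: "i < length (sandwich u)"
    and inner: "0 \<le> \<sigma> * coord u i" "\<sigma> * coord u i \<le> \<sigma> * coord v j"
    and room: "\<sigma> * coord v j + int (Suc n * P) \<le> int (length (side \<sigma>))"
  obtains j' where "j' < length (sandwich v)" "\<sigma> * coord v j < \<sigma> * coord v j'"
    "drifted \<sigma> n u i v j'"
proof -
  let ?p = "nat (\<sigma> * coord v j)"
  have "sandwich u ! i \<in> set (side \<sigma>)"
    using i_less letters inner(1) unit by (rule sandwich_nth_in_side)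
  moreover have "\<sigma> * coord v j + int P \<le> int (length (side \<sigma>))"
    by (rule order_trans[OF _ room]) simp
  then have fits: "?p + P \<le> length (side \<sigma>)"
    using order_trans[OF inner] by (simp flip: zle_int)
  ultimately obtain q where hit: "q \<in> {?p..<?p + P}" "side \<sigma> ! q = sandwich u ! i"
    using recurrent_side[of \<sigma>] unfolding recurrent_def by blast
  define \<alpha> where "\<alpha> = \<sigma> * int (Suc q)"
  have side_\<alpha>: "side \<alpha> = side \<sigma>" "\<bar>\<alpha>\<bar> = int (Suc q)" "\<sigma> * \<alpha> = int (Suc q)"
    using unit by (auto simp: \<alpha>_def side_def abs_mult abs_if zero_less_mult_iff split: if_splits)
  then have "\<alpha> \<noteq> 0" "\<bar>\<alpha>\<bar> \<le> int (length (side \<alpha>))" using hit(1) fits by auto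
  then obtain j' where reply: "j' < length (sandwich v)" "coord v j' = \<alpha>" by (rule coord_surj)
  have "sandwich v ! j' = sandwich u ! i"
    using sandwich_nth_side(2)[of v j'] reply side_\<alpha> hit(2) by (auto simp: nat_add_distrib)
  then have "drifted \<sigma> n u i v j'"
    using unit inner hit(1) room reply(2) side_\<alpha>(3) by (auto simp: drifted_def algebra_simps)
  moreover have "\<sigma> * coord v j < \<sigma> * coord v j'" using hit(1) reply(2) side_\<alpha>(3) inner by auto
  ultimately show thesis using reply(1) that by blast
qed

lemma aligned_Suc_depth: "aligned m (Suc n) u i v j \<Longrightarrow> aligned m n u i v j"
  unfolding aligned_def using game_Suc_depth by blast

lemma drifted_Suc_depth: "drifted \<sigma> (Suc n) u i v j \<Longrightarrow> drifted \<sigma> n u i v j"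
  by (simp add: drifted_def)

lemma linked_Suc_depth: "linked m (Suc n) u i v j \<Longrightarrow> linked m n u i v j"
  unfolding linked_def using aligned_Suc_depth drifted_Suc_depth by blast

lemma copy_forth:
  assumes equiv: "game_equiv 1 m n u v" and i'_less: "i' < length (sandwich u)"
    and direction: "capped_diff 1 i i' = sgn (coord u i' - coord v j)"
    and outside: "coord v j \<noteq> 0 \<or> coord u i' \<noteq> 0"
  obtains j' where "j' < length (sandwich v)" "capped_diff 1 i i' = capped_diff 1 j j'"
    "linked m n u i' v j'"
proof -
  obtain j' where reply: "j' < length (sandwich v)" "aligned m n u i' v j'"
    using equiv i'_less by (rule aligned_reply)
  then have "coord v j' = coord u i'" by (simp add: aligned_def)
  then have "capped_diff 1 i i' = capped_diff 1 j j'"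
    using direction outside capped_diff_coord[of v j j'] by simp
  then show thesis using that reply i'_less by (simp add: linked_def)
qed

lemma drift_forth:
  assumes sets: "set u \<subseteq> set C" "set u \<subseteq> set D" and i'_less: "i' < length (sandwich u)"
    and direction: "\<sigma> = capped_diff 1 i i'" "\<bar>\<sigma>\<bar> = 1"
    and inner: "0 \<le> \<sigma> * coord u i'" "\<sigma> * coord u i' \<le> \<sigma> * coord v j"
    and room: "\<sigma> * coord v j + int (Suc n * P) \<le> int (length (side \<sigma>))"
  obtains j' where "j' < length (sandwich v)" "capped_diff 1 i i' = capped_diff 1 j j'"
    "linked 0 n u i' v j'"
proof -
  have "set u \<subseteq> set (side \<sigma>)" using sets by (simp add: side_def)
  with direction(2) obtain j' where reply: "j' < length (sandwich v)"
      "\<sigma> * coord v j < \<sigma> * coord v j'" "drifted \<sigma> n u i' v j'"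
    using i'_less inner room by (rule drifted_reply)
  have "coord v j' \<noteq> 0" using reply(2) inner by auto
  then have "capped_diff 1 j j' = sgn (coord v j' - coord v j)"
    by (intro capped_diff_coord) simp
  also have "\<dots> = \<sigma>" using reply(2) direction(2) by (auto simp: sgn_if abs_if split: if_splits)
  finally show thesis using that[OF reply(1)] i'_less reply(1,3) direction(1) by (auto simp: linked_def)
qed

lemma middle_forth:
  assumes aligned: "aligned (Suc m) (Suc n) u i v j" and i'_less: "i' < length (sandwich u)"
    and middle: "coord u i = 0" "coord u i' = 0"
  obtains j' where "j' < length (sandwich v)" "capped_diff 1 i i' = capped_diff 1 j j'"
    "linked (Suc m) n u i' v j'"
proof -
  let ?c = "length C"
  have "coord v j = 0" and game: "game 1 (Suc m) (Suc n) u (i - ?c) v (j - ?c)"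
    using middle(1) aligned by (simp_all add: aligned_def)
  then have "i' - ?c < length u" and right_of_left_context: "?c \<le> i" "?c \<le> i'" "?c \<le> j"
    using middle by (auto simp: coord_eq_0_iff)
  with game obtain b where reply: "b < length v"
      "capped_diff 1 (i - ?c) (i' - ?c) = capped_diff 1 (j - ?c) b"
      "game 1 (Suc m) n u (i' - ?c) v b"
    using game_forth by blast
  have "capped_diff 1 i i' = capped_diff 1 j (?c + b)"
    using reply(2) right_of_left_context by (simp add: capped_diff_def of_nat_diff algebra_simps)
  moreover have "linked (Suc m) n u i' v (?c + b)"
    using reply(1,3) middle(2) sandwich_middle[OF reply(1)] i'_less
    by (simp add: linked_def aligned_def)
  ultimately show thesis using that sandwich_middle(1)[OF reply(1)] by blast
qed

lemma capped_diff_coord_cases: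
  assumes "i' \<noteq> i"
  shows "capped_diff 1 i i' = 1 \<and> coord u i \<le> coord u i' \<or>
    capped_diff 1 i i' = -1 \<and> coord u i' \<le> coord u i"
  using assms coord_mono[of i i' u] coord_mono[of i' i u]
  by (auto simp: capped_diff_def min_def max_def)

lemma aligned_forth:
  assumes aligned: "aligned m (Suc n) u i v j" and "i' \<noteq> i"
    and equiv: "game_equiv 1 m n u v" and sets: "set u \<subseteq> set C" "set u \<subseteq> set D"
    and long: "Suc n * P \<le> length C" "Suc n * P \<le> length D" and i'_less: "i' < length (sandwich u)"
  obtains j' where "j' < length (sandwich v)" "capped_diff 1 i i' = capped_diff 1 j j'"
    "linked m n u i' v j'"
proof (cases "coord u i = 0 \<and> coord u i' = 0")
  case False
  moreover have "coord v j = coord u i" using aligned by (simp add: aligned_def)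
  ultimately have "capped_diff 1 i i' = sgn (coord u i' - coord v j)"
    "coord v j \<noteq> 0 \<or> coord u i' \<noteq> 0"
    using capped_diff_coord[of u i i'] by auto
  with equiv i'_less show thesis using that by (rule copy_forth)
next
  case middle: True
  show thesis
  proof (cases m)
    case 0
    let ?\<sigma> = "capped_diff 1 i i'"
    have unit: "\<bar>?\<sigma>\<bar> = 1" using capped_diff_coord_cases[OF \<open>i' \<noteq> i\<close>, of u] by auto
    have center: "coord v j = 0" "coord u i' = 0"
      using aligned middle by (simp_all add: aligned_def)
    have "int (Suc n * P) \<le> int (length (side ?\<sigma>))"
      using long by (auto simp only: side_def of_nat_le_iff split: if_split)
    then have "0 \<le> ?\<sigma> * coord u i'" "?\<sigma> * coord u i' \<le> ?\<sigma> * coord v j"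
      "?\<sigma> * coord v j + int (Suc n * P) \<le> int (length (side ?\<sigma>))"
      unfolding center by simp_all
    with sets i'_less refl unit show thesis using that[unfolded 0] by (rule drift_forth)
  next
    case (Suc k)
    show thesis
      using aligned[unfolded Suc] i'_less conjunct1[OF middle] conjunct2[OF middle]
        that[unfolded Suc]
      by (rule middle_forth)
  qed
qed

lemma drifted_forth:
  assumes drifted: "drifted \<sigma> (Suc n) u i v j" and "i' \<noteq> i"
    and equiv: "game_equiv 1 0 n u v" and sets: "set u \<subseteq> set C" "set u \<subseteq> set D"
    and i'_less: "i' < length (sandwich u)"
  obtains j' where "j' < length (sandwich v)" "capped_diff 1 i i' = capped_diff 1 j j'"
    "linked 0 n u i' v j'"
proof -
  have unit: "\<bar>\<sigma>\<bar> = 1" "\<sigma> = 1 \<or> \<sigma> = -1"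
    and inner: "0 \<le> \<sigma> * coord u i" "\<sigma> * coord u i < \<sigma> * coord v j"
    and room: "\<sigma> * coord v j + int (Suc n * P) \<le> int (length (side \<sigma>))"
    using drifted by (auto simp: drifted_def)
  note direction = capped_diff_coord_cases[OF \<open>i' \<noteq> i\<close>, of u]
  show thesis
  proof (cases "capped_diff 1 i i' = \<sigma> \<and> \<sigma> * coord u i' \<le> \<sigma> * coord v j")
    case True
    have "0 \<le> \<sigma> * coord u i'" using True inner(1) direction by (elim disjE) auto
    moreover have "\<sigma> = capped_diff 1 i i'" "\<sigma> * coord u i' \<le> \<sigma> * coord v j" using True by simp_all
    ultimately show thesis using drift_forth[OF sets i'_less _ unit(1)] room that by blast
  next
    case False
    have "coord v j \<noteq> 0" using inner by auto
    moreover have "capped_diff 1 i i' = sgn (coord u i' - coord v j)"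
      using False unit(2) inner(2) direction by (elim disjE) (simp_all add: sgn_if)
    ultimately show thesis using copy_forth[OF equiv i'_less] that by blast
  qed
qed

lemma linked_forth:
  assumes linked: "linked m (Suc n) u i v j" and equiv: "game_equiv 1 m n u v"
    and sets: "set u \<subseteq> set C" "set u \<subseteq> set D"
    and long: "Suc n * P \<le> length C" "Suc n * P \<le> length D"
    and i'_less: "i' < length (sandwich u)"
  obtains j' where "j' < length (sandwich v)" "capped_diff 1 i i' = capped_diff 1 j j'"
    "linked m n u i' v j'"
proof (cases "i' = i")
  case True
  then show thesis
    using linked linked_Suc_depth by (intro that[of j]) (auto simp: linked_def)
next
  case moved: False
  show thesis
  proof (cases "aligned m (Suc n) u i v j")
    case True
    then show thesis using moved equiv sets long i'_less that by (rule aligned_forth)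
  next
    case False
    then obtain \<sigma> where "m = 0" "drifted \<sigma> (Suc n) u i v j" using linked by (auto simp: linked_def)
    then show thesis using drifted_forth[OF _ moved _ sets i'_less] equiv that by blast
  qed
qed

lemma linked_imp_game:
  assumes "linked m n u i v j" "game_equiv 1 m n u v" "set u \<subseteq> set C" "set u \<subseteq> set D"
    and "n * P \<le> length C" "n * P \<le> length D"
  shows "game 1 (Suc m) n (sandwich u) i (sandwich v) j"
  using assms
proof (induction "m + n" arbitrary: m n u i v j rule: less_induct)
  case less
  show ?case
  proof (cases n)
    case 0
    then show ?thesis using linked_imp_nth_eq less.prems(1) by simp
  next
    case (Suc n')
    have "game 1 m (Suc n') (sandwich v) j (sandwich u) i"
    proof (cases m)
      case 0
      then show ?thesis using linked_imp_nth_eq less.prems(1) by simp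
    next
      case (Suc k)
      have "game 1 (Suc k) n (sandwich v) j (sandwich u) i"
      proof (rule less.hyps)
        show "linked k n v j u i" using less.prems(1) Suc linked_swap by blast
        show "game_equiv 1 k n v u"
          using game_equiv_sym[OF less.prems(2)] Suc by (simp add: game_equiv_mono)
        show "set v \<subseteq> set C" "set v \<subseteq> set D"
          using less.prems(3,4) game_equiv_imp_set_eq[OF less.prems(2)] by simp_all
      qed (use less.prems(5,6) Suc in simp_all)
      then show ?thesis using Suc \<open>n = Suc n'\<close> by simp
    qed
    moreover have "\<exists>j'<length (sandwich v). capped_diff 1 i i' = capped_diff 1 j j' \<and>
        game 1 (Suc m) n' (sandwich u) i' (sandwich v) j'"
      if i'_less: "i' < length (sandwich u)" for i'
    proof -
      have equiv: "game_equiv 1 m n' u v" using less.prems(2) Suc by (simp add: game_equiv_mono)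
      obtain j' where reply: "j' < length (sandwich v)" "capped_diff 1 i i' = capped_diff 1 j j'"
          "linked m n' u i' v j'"
        using less.prems(1)[unfolded Suc] equiv less.prems(3-6)[unfolded Suc] i'_less
        by (rule linked_forth)
      have "game 1 (Suc m) n' (sandwich u) i' (sandwich v) j'"
        by (rule less.hyps[OF _ reply(3) equiv less.prems(3,4)])
          (use less.prems(5,6) Suc in simp_all)
      then show ?thesis using reply(1,2) by blast
    qed
    ultimately show ?thesis unfolding Suc game.simps(3) by blast
  qed
qed

lemma game_equiv_sandwich:
  assumes "game_equiv 1 m n u v" "set u \<subseteq> set C" "set u \<subseteq> set D"
    and "n * P \<le> length C" "n * P \<le> length D"
  shows "game_equiv 1 (Suc m) n (sandwich u) (sandwich v)"
proof -
  have reply: "\<exists>j<length (sandwich v'). game 1 (Suc m) n (sandwich u') i (sandwich v') j"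
    if i_less: "i < length (sandwich u')" and equiv: "game_equiv 1 m n u' v'"
      and sets: "set u' \<subseteq> set C" "set u' \<subseteq> set D" for u' v' i
  proof -
    obtain j where copy: "j < length (sandwich v')" "aligned m n u' i v' j"
      using equiv i_less by (rule aligned_reply)
    then have "linked m n u' i v' j" using copy i_less by (simp add: linked_def)
    from linked_imp_game[OF this equiv sets assms(4,5)] show ?thesis using copy(1) by blast
  qed
  have "set v \<subseteq> set C" "set v \<subseteq> set D"
    using assms(2,3) game_equiv_imp_set_eq[OF assms(1)] by simp_all
  from reply[OF _ assms(1-3)] reply[OF _ game_equiv_sym[OF assms(1)] this] show ?thesis
    unfolding game_equiv_def[of 1 "Suc m"] by (intro conjI allI impI)
qed

end

section \<open>Padding makes the successor relation useless\<close>

definition stride :: "nat \<Rightarrow> nat" where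
  "stride K = 2 * K + 1"

lemma less_stride [simp]: "K < stride K" and stride_pos [simp]: "0 < stride K"
  by (simp_all add: stride_def)

definition pad :: "nat \<Rightarrow> 'a \<Rightarrow> 'a list \<Rightarrow> 'a list" where
  "pad K h w = concat (map (\<lambda>a. replicate K h @ a # replicate K h) w)"

lemma length_pad [simp]: "length (pad K h w) = stride K * length w"
  unfolding pad_def
  by (subst length_concat_equal_length[where k = "stride K"]) (auto simp: stride_def)

lemma set_pad_subset: "set (pad K h w) \<subseteq> insert h (set w)"
  by (auto simp: pad_def)

lemma nth_pad:
  assumes "p < length (pad K h w)"
  shows "pad K h w ! p = (if p mod stride K = K then w ! (p div stride K) else h)"
proof -
  have "p div stride K < length w"
    using assms by (simp add: less_mult_imp_div_less mult.commute)
  moreover have "(replicate K h @ a # replicate K h) ! q = (if q = K then a else h)"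
    if "q < stride K" for a q
    using that by (auto simp: nth_append nth_Cons' stride_def)
  moreover have "p mod stride K < stride K" by (simp add: stride_def)
  moreover have "p < stride K * length w" using assms by simp
  ultimately show ?thesis
    unfolding pad_def
    by (subst nth_concat_equal_length[where k = "stride K"]) (auto simp: stride_def)
qed

definition anchor :: "nat \<Rightarrow> nat \<Rightarrow> nat" where
  "anchor K q = stride K * q + K"

lemma anchor_less: "q < l \<Longrightarrow> anchor K q < stride K * l"
  using mult_le_mono2[of "Suc q" l "stride K"] less_stride[of K]
  by (simp add: anchor_def del: less_stride)

lemma anchor_mod_div: "anchor K q mod stride K = K" "anchor K q div stride K = q"
  by (simp_all add: anchor_def)

lemma mod_stride_eq_iff: "p mod stride K = K \<longleftrightarrow> p = anchor K (p div stride K)"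
  by (metis anchor_def anchor_mod_div(1) mult_div_mod_eq)

lemma guarded_embedding_pad:
  assumes "h \<notin> set w"
  shows "guarded_embedding (NLett h) (anchor K) w (pad K h w)"
proof -
  have nth_anchor: "pad K h w ! anchor K i = w ! i" if "i < length w" for i
    using nth_pad[of "anchor K i" K h w] anchor_less[OF that] by (simp add: anchor_mod_div)
  have "pad K h w ! p \<noteq> h \<longleftrightarrow> p \<in> anchor K ` {..<length w}" if p_less: "p < length (pad K h w)" for p
  proof
    assume "pad K h w ! p \<noteq> h"
    then have "p mod stride K = K" using nth_pad[OF p_less] by (auto split: if_splits)
    then have "p = anchor K (p div stride K)" by (simp only: mod_stride_eq_iff)
    moreover have "p div stride K < length w"
      using p_less by (simp add: less_mult_imp_div_less mult.commute)
    ultimately show "p \<in> anchor K ` {..<length w}" by blast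
  next
    assume "p \<in> anchor K ` {..<length w}"
    then show "pad K h w ! p \<noteq> h" using assms nth_anchor by (auto simp: in_set_conv_nth)
  qed
  moreover have "strict_mono_on {..<length w} (anchor K)"
    by (intro strict_mono_onI) (simp add: anchor_def)
  ultimately show ?thesis
    using nth_anchor anchor_less by (simp add: guarded_embedding_def)
qed

definition displaced :: "nat \<Rightarrow> nat \<Rightarrow> int \<Rightarrow> nat \<Rightarrow> bool" where
  "displaced K q d p \<longleftrightarrow> int p = int (anchor K q) + d"

lemma nth_pad_displaced:
  assumes "displaced K q d p" "\<bar>d\<bar> \<le> 2 * int K" "p < length (pad K h w)"
  shows "pad K h w ! p = (if d = 0 then w ! q else h)"
proof (cases "d = 0")
  case True
  then have "p = anchor K q" using assms(1) by (simp add: displaced_def)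
  then show ?thesis using True nth_pad[OF assms(3)] by (simp add: anchor_mod_div)
next
  case False
  have "p mod stride K \<noteq> K"
  proof
    assume "p mod stride K = K"
    then have "int p = int (anchor K (p div stride K))" by (simp only: mod_stride_eq_iff)
    then have "d = int (stride K) * (int (p div stride K) - int q)"
      using assms(1) by (simp add: displaced_def anchor_def algebra_simps)
    then have "int (stride K) dvd d" by simp
    then show False
      using False assms(2) zdvd_imp_le[of "int (stride K)" "\<bar>d\<bar>"] by (simp add: stride_def)
  qed
  then show ?thesis using False nth_pad[OF assms(3)] by simp
qed

lemma displaced_in_range:
  assumes displaced: "displaced K q d p" "p < stride K * l" "\<bar>d\<bar> \<le> 2 * int K"
    and letters: "q < l" "q' < l'" "q' = 0 \<Longrightarrow> q = 0" "Suc q' = l' \<Longrightarrow> Suc q = l"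
  obtains p' where "displaced K q' d p'" "p' < stride K * l'"
proof -
  have stride: "int (stride K) = 2 * int K + 1" by (simp add: stride_def)
  have "0 \<le> int (anchor K q') + d"
  proof (cases q')
    case 0
    then show ?thesis using displaced(1) letters(3) by (simp add: displaced_def)
  next
    case (Suc r)
    have "int (stride K) * int q' = int (stride K) + int (stride K) * int r"
      unfolding Suc by (simp add: algebra_simps)
    moreover have "0 \<le> int (stride K) * int r" by simp
    ultimately show ?thesis
      using displaced(3) stride unfolding anchor_def of_nat_add of_nat_mult by linarith
  qed
  moreover have "int (anchor K q') + d < int (stride K * l')"
  proof (cases "Suc q' = l'")
    case True
    then have lengths: "l = Suc q" "l' = Suc q'" using letters(4) by simp_all
    have "int p < int (stride K * l)" using displaced(2) by (simp only: of_nat_less_iff)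
    then show ?thesis
      using displaced(1) unfolding lengths displaced_def anchor_def by (simp add: algebra_simps)
  next
    case False
    then obtain r where "l' = Suc (Suc q') + r"
      using letters(2) by (metis Suc_leI le_Suc_ex le_neq_implies_less)
    then have "int (stride K * l') =
        2 * int (stride K) + int (stride K) * int q' + int (stride K) * int r"
      by (simp add: algebra_simps)
    moreover have "0 \<le> int (stride K) * int r" by simp
    ultimately show ?thesis
      using displaced(3) stride unfolding anchor_def of_nat_add of_nat_mult by linarith
  qed
  ultimately show thesis
    by (intro that[of "nat (int (anchor K q') + d)"]) (simp_all add: displaced_def nat_less_iff)
qed

lemma nearest_anchor_towards:
  fixes e M B :: int
  assumes "0 \<le> M" "M < \<bar>e\<bar>" "0 < B"
  obtains z where "sgn z = sgn e" "M - B < sgn e * (e - z * B)" "sgn e * (e - z * B) \<le> M"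
proof -
  define y where "y = (\<bar>e\<bar> - M + B - 1) div B"
  have "y * B + (\<bar>e\<bar> - M + B - 1) mod B = \<bar>e\<bar> - M + B - 1"
    unfolding y_def by (rule div_mult_mod_eq)
  moreover have "0 \<le> (\<bar>e\<bar> - M + B - 1) mod B" "(\<bar>e\<bar> - M + B - 1) mod B < B"
    using assms(3) by simp_all
  ultimately have bounds: "M - B < \<bar>e\<bar> - y * B" "\<bar>e\<bar> - y * B \<le> M" by linarith+
  have "0 < y" unfolding y_def using assms by (simp add: pos_imp_zdiv_pos_iff)
  moreover have "sgn e * (e - sgn e * y * B) = \<bar>e\<bar> - y * B"
    using assms(1,2) by (auto simp: sgn_if algebra_simps)
  ultimately show thesis
    using bounds assms(1,2) by (intro that[of "sgn e * y"]) (auto simp: sgn_mult)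
qed

lemma displaced_towards:
  fixes M :: int
  assumes less: "q < l" "r < stride K * l" and M_ge: "int K \<le> M"
    and far: "M < \<bar>int r - int (anchor K q)\<bar>" and \<sigma>_eq: "\<sigma> = sgn (int r - int (anchor K q))"
  obtains a d where "a < l" "displaced K a d r" "sgn (int a - int q) = \<sigma>"
    "M - int (stride K) < \<sigma> * d" "\<sigma> * d \<le> M"
proof -
  let ?B = "int (stride K)"
  define e where "e = int r - int (anchor K q)"
  obtain z where sgn_z: "sgn z = \<sigma>" and offset: "M - ?B < \<sigma> * (e - z * ?B)" "\<sigma> * (e - z * ?B) \<le> M"
    using nearest_anchor_towards[of M e ?B] M_ge far unfolding \<sigma>_eq e_def by auto
  have stride: "?B = 2 * int K + 1" by (simp add: stride_def)
  have \<sigma>_cases: "\<sigma> = 1 \<and> 0 < z \<or> \<sigma> = -1 \<and> z < 0"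
    using sgn_z far M_ge unfolding \<sigma>_eq by (auto simp: sgn_if split: if_splits)
  have r_eq: "int r = (int q + z) * ?B + int K + (e - z * ?B)"
    by (simp add: e_def anchor_def algebra_simps)
  have "0 \<le> int q + z"
  proof (rule ccontr)
    assume negative: "\<not> 0 \<le> int q + z"
    then have "(int q + z) * ?B \<le> (-1) * ?B" by (intro mult_right_mono) auto
    then show False using r_eq offset(1) \<sigma>_cases negative M_ge by auto
  qed
  moreover have "int q + z < int l"
  proof (rule ccontr)
    assume beyond: "\<not> int q + z < int l"
    then have "int l * ?B \<le> (int q + z) * ?B" by (intro mult_right_mono) auto
    moreover have "int r < int l * ?B"
      using less(2) by (metis mult.commute of_nat_less_iff of_nat_mult)
    moreover have "\<sigma> = 1" using \<sigma>_cases beyond less(1) by linarith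
    then have "M - ?B < e - z * ?B" using offset(1) by simp
    ultimately show False using r_eq M_ge stride by linarith
  qed
  moreover from this have "displaced K (nat (int q + z)) (e - z * ?B) r"
    using r_eq \<open>0 \<le> int q + z\<close> by (simp add: displaced_def anchor_def algebra_simps)
  ultimately show thesis
    using sgn_z offset by (intro that[of "nat (int q + z)" "e - z * ?B"]) (auto simp: nat_less_iff)
qed

lemma displaced_far_apart:
  assumes unit: "\<bar>\<sigma>\<bar> = 1" and towards: "sgn (int b - int q) = \<sigma>"
    and displaced: "displaced K q d p" "displaced K b e r"
    and bounds: "\<bar>d\<bar> < M" "M - int (stride K) < \<sigma> * e"
  shows "2 \<le> \<sigma> * (int r - int p)"
proof -
  have "1 \<le> \<sigma> * (int b - int q)" using unit towards by (auto simp: sgn_if split: if_splits)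
  then have "int (stride K) \<le> int (stride K) * (\<sigma> * (int b - int q))" by simp
  also have "\<dots> = \<sigma> * (int r - int p) - \<sigma> * e + \<sigma> * d"
    using displaced by (simp add: displaced_def anchor_def algebra_simps)
  finally show ?thesis using bounds unit by (auto simp: abs_if split: if_splits)
qed

lemma displaced_reply:
  assumes game: "game 1 (Suc m) (Suc n) w q w' q'" and letters: "q < length w" "q' < length w'"
    and displaced: "displaced K q d p" "p < stride K * length w" "\<bar>d\<bar> \<le> 2 * int K"
  obtains p' where "displaced K q' d p'" "p' < stride K * length w'"
proof (rule displaced_in_range[OF displaced letters])
  show "q = 0" if "q' = 0" using game_first[of 1 m n w q w'] game letters(1) that by simp
  show "Suc q = length w" if "Suc q' = length w'"
    using game_last[OF game letters(1) that] by simp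
qed

text \<open>A move to within \<open>M\<close> of the current anchor keeps the anchor. After a longer move in direction
  \<open>\<sigma>\<close> the new anchor is chosen such that the displacement exceeds \<open>M - stride K\<close> in direction
  \<open>\<sigma>\<close>: even if the reply in the unpadded game is the very next letter, Duplicator's position
  then moves by at least \<open>2\<close>.\<close>

lemma pad_forth:
  assumes game: "game 1 (Suc m) (Suc (Suc n)) w q w' q'"
    and letters: "q < length w" "q' < length w'"
    and bounds: "int K \<le> M" "M \<le> 2 * int K" "\<bar>d\<bar> < M"
    and displaced: "displaced K q d p" "displaced K q' d p'"
    and move: "r < stride K * length w"
  obtains a b e r' where "a < length w" "b < length w'" "game 1 (Suc m) (Suc n) w a w' b"
    "\<bar>e\<bar> \<le> M" "displaced K a e r" "displaced K b e r'" "r' < stride K * length w'"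
    "capped_diff 2 p r = capped_diff 2 p' r'"
proof (cases "\<bar>int r - int (anchor K q)\<bar> \<le> M")
  case True
  define e where "e = int r - int (anchor K q)"
  have offset: "displaced K q e r" "\<bar>e\<bar> \<le> M" using True by (simp_all add: displaced_def e_def)
  have game': "game 1 (Suc m) (Suc n) w q w' q'" using game by (rule game_Suc_depth)
  obtain r' where reply: "displaced K q' e r'" "r' < stride K * length w'"
    by (rule displaced_reply[OF game' letters offset(1) move]) (use offset(2) bounds in simp)
  have "int r - int p = int r' - int p'"
    using offset(1) reply(1) displaced by (simp add: displaced_def)
  then have "capped_diff 2 p r = capped_diff 2 p' r'" by (simp add: capped_diff_def)
  with letters game' offset(2,1) reply show thesis by (rule that)
next
  case False
  define \<sigma> where "\<sigma> = sgn (int r - int (anchor K q))"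
  have unit: "\<bar>\<sigma>\<bar> = 1" using False bounds unfolding \<sigma>_def by (auto simp: sgn_if)
  obtain a e where anchor: "a < length w" "displaced K a e r" "sgn (int a - int q) = \<sigma>"
      and offset: "M - int (stride K) < \<sigma> * e" "\<sigma> * e \<le> M"
    using displaced_towards[OF letters(1) move bounds(1)] False unfolding \<sigma>_def by auto
  have e_le: "\<bar>e\<bar> \<le> M" using offset unit bounds(1) by (auto simp: stride_def abs_if split: if_splits)
  obtain b where reply: "b < length w'" "capped_diff 1 q a = capped_diff 1 q' b"
      "game 1 (Suc m) (Suc n) w a w' b"
    using game anchor(1) by (rule game_forth)
  obtain r' where padded_reply: "displaced K b e r'" "r' < stride K * length w'"
    by (rule displaced_reply[OF reply(3) anchor(1) reply(1) anchor(2) move])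
      (use e_le bounds in simp)
  have "sgn (int b - int q') = \<sigma>" using anchor(3) reply(2) unfolding capped_diff_1 by simp
  then have "2 \<le> \<sigma> * (int r' - int p')"
    using unit displaced(2) padded_reply(1) bounds(3) offset(1) by (intro displaced_far_apart)
  moreover have "2 \<le> \<sigma> * (int r - int p)"
    using unit anchor(3,2) displaced(1) bounds(3) offset(1) by (intro displaced_far_apart)
  ultimately have "capped_diff 2 p r = capped_diff 2 p' r'"
    using unit by (simp add: capped_diff_far[of \<sigma> 2])
  with anchor(1) reply(1,3) e_le anchor(2) padded_reply show thesis by (rule that)
qed

lemma game_pad:
  assumes "game 1 m (Suc n) w q w' q'" "q < length w" "q' < length w'"
    and "n \<le> K" "\<bar>d\<bar> \<le> 2 * int K - int n"
    and "displaced K q d p" "displaced K q' d p'"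
    and "p < stride K * length w" "p' < stride K * length w'"
  shows "game 2 m n (pad K h w) p (pad K h w') p'"
  using assms
proof (induction "m + n" arbitrary: m n w q w' q' d p p' rule: less_induct)
  case less
  have same_letter: "pad K h w ! p = pad K h w' ! p'"
    using nth_pad_displaced[of K q d p h w] nth_pad_displaced[of K q' d p' h w']
      game_imp_nth_eq[OF less.prems(1)] less.prems(4-9) by simp
  show ?case
  proof (cases "m = 0 \<or> n = 0")
    case True
    then show ?thesis using same_letter by (auto simp: game_no_moves)
  next
    case False
    then obtain k l where m_eq: "m = Suc k" and n_eq: "n = Suc l" by (meson not0_implies_Suc)
    have "game 2 k n (pad K h w') p' (pad K h w) p"
    proof (rule less.hyps[OF _ _ less.prems(3,2,4,5,7,6,9,8)])
      show "game 1 k (Suc n) w' q' w q" using less.prems(1) unfolding m_eq by (rule game_swap)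
    qed (simp add: m_eq)
    moreover have "\<exists>r'<length (pad K h w'). capped_diff 2 p r = capped_diff 2 p' r' \<and>
        game 2 m l (pad K h w) r (pad K h w') r'" if r_less: "r < length (pad K h w)" for r
    proof -
      obtain a b e r' where "a < length w" "b < length w'" "game 1 m (Suc l) w a w' b"
        "\<bar>e\<bar> \<le> 2 * int K - int l" "displaced K a e r" "displaced K b e r'"
        "r' < stride K * length w'" "capped_diff 2 p r = capped_diff 2 p' r'"
        using pad_forth[OF less.prems(1)[unfolded m_eq n_eq] less.prems(2,3) _ _ _ less.prems(6,7),
            of "2 * int K - int l" r thesis] less.prems(4,5) r_less n_eq m_eq by simp
      then show ?thesis using less.hyps[of m l w a w' b e r r'] less.prems(4) r_less n_eq by auto
    qed
    ultimately show ?thesis unfolding m_eq n_eq by simp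
  qed
qed

lemma game_equiv_pad:
  assumes equiv: "game_equiv 1 m (Suc n) w w'" and n_le: "n \<le> K"
  shows "game_equiv 2 m n (pad K h w) (pad K h w')"
proof -
  have "\<exists>p'<length (pad K h v). game 2 m n (pad K h u) p (pad K h v) p'"
    if equiv: "game_equiv 1 m (Suc n) u v" and p_less: "p < length (pad K h u)" for u v p
  proof -
    define rest where "rest = p mod stride K"
    let ?q = "p div stride K" and ?d = "int rest - int K"
    have q_less: "?q < length u" using p_less by (simp add: less_mult_imp_div_less mult.commute)
    with equiv obtain q' where reply: "q' < length v" "game 1 m (Suc n) u ?q v q'"
      by (rule game_equiv_forth)
    have rest_less: "rest < stride K" by (simp add: rest_def)
    have "\<bar>?d\<bar> \<le> 2 * int K - int n" using n_le rest_less by (auto simp: stride_def)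
    moreover have "stride K * q' + rest < stride K * length v"
      using mult_le_mono2[of "Suc q'" "length v" "stride K"] reply(1) rest_less by simp
    moreover have "p = stride K * ?q + rest" by (simp add: rest_def)
    then have "displaced K ?q ?d p" "displaced K q' ?d (stride K * q' + rest)"
      unfolding displaced_def anchor_def by linarith+
    ultimately show ?thesis using game_pad[OF reply(2) q_less reply(1) n_le] p_less by auto
  qed
  from this[OF equiv] this[OF game_equiv_sym[OF equiv]] show ?thesis
    by (simp add: game_equiv_def)
qed

section \<open>Hard sentences\<close>

definition between :: "'a \<Rightarrow> 'a \<Rightarrow> var \<Rightarrow> 'a fo2" where
  "between x y v = All (other v)
     (And (Or (Less (other v) v) (NLett x (other v))) (Or (Less v (other v)) (NLett y (other v))))"

lemma sat_between:
  "sat w s (between x y v) \<longleftrightarrow>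
     (\<forall>p<length w. (w ! p = x \<longrightarrow> p < s v) \<and> (w ! p = y \<longrightarrow> s v < p))"
  by (auto simp: between_def)

lemma sat_between_contexts:
  assumes left: "C \<noteq> []" "hd C = x" "x \<notin> set u \<union> set D"
    and right: "D \<noteq> []" "hd D = y" "y \<notin> set u \<union> set C"
  shows "sat (rev C @ u @ D) s (between x y v) \<longleftrightarrow>
      length C \<le> s v \<and> s v < length C + length u"
proof -
  let ?w = "rev C @ u @ D" and ?c = "length C" and ?d = "length C + length u"
  have last_x: "?w ! (?c - 1) = x" "?c - 1 < ?c"
    using left(1,2) by (simp_all add: nth_append rev_nth hd_conv_nth)
  have first_y: "?w ! ?d = y" "?d < length ?w"
    using right(1,2) by (auto simp: nth_append hd_conv_nth)
  have x_left: "p < ?c" if "?w ! p = x" "p < length ?w" for p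
  proof (rule ccontr)
    assume "\<not> p < ?c"
    then have "?w ! p = (u @ D) ! (p - ?c)" "p - ?c < length (u @ D)"
      using that(2) by (auto simp: nth_append)
    then have "?w ! p \<in> set (u @ D)" using nth_mem by metis
    then show False using that(1) left(3) by simp
  qed
  have y_right: "?d \<le> p" if "?w ! p = y" for p
  proof (rule ccontr)
    assume "\<not> ?d \<le> p"
    then have "?w ! p = (rev C @ u) ! p" "p < length (rev C @ u)"
      using nth_append[of "rev C @ u" D p] by simp_all
    then have "?w ! p \<in> set (rev C @ u)" using nth_mem by metis
    then show False using that right(3) by simp
  qed
  show ?thesis
  proof
    assume "sat ?w s (between x y v)"
    then have "?c - 1 < s v" "s v < ?d"
      using last_x first_y unfolding sat_between by (simp_all del: length_append)
    then show "?c \<le> s v \<and> s v < ?d" by simp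
  next
    assume "?c \<le> s v \<and> s v < ?d"
    then show "sat ?w s (between x y v)"
      using x_left y_right unfolding sat_between by (metis less_le_trans)
  qed
qed

lemma guarded_embedding_between:
  assumes "C \<noteq> []" "hd C = x" "x \<notin> set u \<union> set D" and "D \<noteq> []" "hd D = y" "y \<notin> set u \<union> set C"
  shows "guarded_embedding (between x y) (\<lambda>i. length C + i) u (rev C @ u @ D)"
proof -
  have "sat (rev C @ u @ D) s (between x y v) \<longleftrightarrow> s v \<in> (\<lambda>i. length C + i) ` {..<length u}" for s v
    unfolding sat_between_contexts[OF assms]
    by (auto simp: image_iff intro!: bexI[of _ "s v - length C"])
  then show ?thesis
    by (auto simp: guarded_embedding_def nth_append intro!: strict_mono_onI)
qed

definition hard_sentence :: "nat \<Rightarrow> nat \<Rightarrow> nat \<Rightarrow> nat fo2 \<Rightarrow> bool" where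
  "hard_sentence t m a \<phi> \<longleftrightarrow> sentence \<phi> \<and> blocks \<phi> \<le> Suc m \<and> letters \<phi> \<subseteq> {..<a} \<and>
     (\<forall>n. \<exists>u v. u \<noteq> [] \<and> v \<noteq> [] \<and> set u \<subseteq> {..<a} \<and> set v \<subseteq> {..<a} \<and>
        game_equiv t m n u v \<and> sat u (\<lambda>_. 0) \<phi> \<and> \<not> sat v (\<lambda>_. 0) \<phi>)"

lemma hard_sentence_relativize:
  assumes hard: "hard_sentence t m a \<phi>" and "suc_free \<phi>" and "a \<le> a'"
    and guard: "\<And>v. free (G v) \<subseteq> {v}" "\<And>v. letters (G v) \<subseteq> {..<a'}"
      "\<And>v. blk (Some True) (G v) \<le> d"
    and embedding: "\<And>n w. set w \<subseteq> {..<a} \<Longrightarrow> guarded_embedding G (e n) w (F n w)"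
      "\<And>n w. set w \<subseteq> {..<a} \<Longrightarrow> set (F n w) \<subseteq> {..<a'}"
    and game_equiv: "\<And>n u v. set u \<subseteq> {..<a} \<Longrightarrow> set v \<subseteq> {..<a} \<Longrightarrow> game_equiv t m (Suc n) u v \<Longrightarrow>
      game_equiv t' (m + d) n (F n u) (F n v)"
  shows "hard_sentence t' (m + d) a' (relativize G \<phi>)"
  unfolding hard_sentence_def
proof (intro conjI allI)
  have base: "sentence \<phi>" "blocks \<phi> \<le> Suc m" "letters \<phi> \<subseteq> {..<a}"
    using hard by (simp_all add: hard_sentence_def)
  show sentence: "sentence (relativize G \<phi>)"
    using free_relativize[OF guard(1)] base(1) by (auto simp: sentence_def)
  show "blocks (relativize G \<phi>) \<le> Suc (m + d)"
    using blk_relativize[of G d None \<phi>, OF guard(3)] base(2) by (simp add: blocks_def)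
  show "letters (relativize G \<phi>) \<subseteq> {..<a'}"
    using base(3) \<open>a \<le> a'\<close> by (intro letters_relativize guard(2)) auto
  have sat_iff: "F n w \<noteq> [] \<and> (sat (F n w) (\<lambda>_. 0) (relativize G \<phi>) \<longleftrightarrow> sat w (\<lambda>_. 0) \<phi>)"
    if "w \<noteq> []" "set w \<subseteq> {..<a}" for n w
  proof -
    have embeds: "guarded_embedding G (e n) w (F n w)" using that(2) by (rule embedding)
    then have "sat (F n w) (e n \<circ> (\<lambda>_. 0)) (relativize G \<phi>) \<longleftrightarrow> sat w (\<lambda>_. 0) \<phi>"
      using \<open>suc_free \<phi>\<close> that(1) by (intro sat_relativize) auto
    moreover have "F n w \<noteq> []" using embeds that(1) by (auto simp: guarded_embedding_def)
    ultimately show ?thesis using sat_sentence_cong[OF sentence] by blast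
  qed
  fix n
  obtain u v where "u \<noteq> []" "v \<noteq> []" "set u \<subseteq> {..<a}" "set v \<subseteq> {..<a}"
      "game_equiv t m (Suc n) u v" "sat u (\<lambda>_. 0) \<phi>" "\<not> sat v (\<lambda>_. 0) \<phi>"
    using hard unfolding hard_sentence_def by blast
  then show "\<exists>u v. u \<noteq> [] \<and> v \<noteq> [] \<and> set u \<subseteq> {..<a'} \<and> set v \<subseteq> {..<a'} \<and>
      game_equiv t' (m + d) n u v \<and> sat u (\<lambda>_. 0) (relativize G \<phi>) \<and>
      \<not> sat v (\<lambda>_. 0) (relativize G \<phi>)"
    using sat_iff embedding(2) game_equiv by (intro exI[of _ "F n u"] exI[of _ "F n v"]) simp
qed

lemma hard_sentence_two_positions: "hard_sentence 1 0 1 (Ex VX (Ex VY (Less VX VY)))"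
  (is "hard_sentence 1 0 1 ?\<phi>")
  unfolding hard_sentence_def
proof (intro conjI allI)
  fix n
  have "game_equiv 1 0 n [0, 0 :: nat] [0]"
    by (auto simp: game_equiv_def less_Suc_eq intro!: exI[of _ 0])
  then show "\<exists>u v. u \<noteq> [] \<and> v \<noteq> [] \<and> set u \<subseteq> {..<1} \<and> set v \<subseteq> {..<1} \<and>
      game_equiv 1 0 n u v \<and> sat u (\<lambda>_. 0) ?\<phi> \<and> \<not> sat v (\<lambda>_. 0) ?\<phi>"
    by - (rule exI[of _ "[0, 0]"], rule exI[of _ "[0]"], auto)
qed (auto simp: sentence_def blocks_def)

lemma hard_sentence_between:
  assumes "hard_sentence 1 m a \<phi>" "suc_free \<phi>"
  shows "hard_sentence 1 (Suc m) (a + 2) (relativize (between a (Suc a)) \<phi>)"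
proof -
  define C D where "C n = concat (replicate (Suc n) (a # [0..<a]))"
    and "D n = concat (replicate (Suc n) (Suc a # [0..<a]))" for n
  have contexts: "recurrent_contexts (C n) (D n) (Suc a)" for n
    using recurrent_concat_replicate[of "a # [0..<a]" "Suc n"]
      recurrent_concat_replicate[of "Suc a # [0..<a]" "Suc n"]
    by (simp add: recurrent_contexts_def C_def D_def)
  have sets: "set (C n) = insert a {..<a}" "set (D n) = insert (Suc a) {..<a}" for n
    by (auto simp: C_def D_def)
  have lengths: "n * Suc a \<le> length (C n)" "n * Suc a \<le> length (D n)" for n
    by (simp_all add: C_def D_def length_concat sum_list_replicate)
  have "hard_sentence 1 (m + 1) (a + 2) (relativize (between a (Suc a)) \<phi>)"
  proof (rule hard_sentence_relativize[OF assms, where F = "\<lambda>n w. rev (C n) @ w @ D n"])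
    fix n w assume "set w \<subseteq> {..<a}"
    then show "guarded_embedding (between a (Suc a)) ((+) (length (C n))) w (rev (C n) @ w @ D n)"
      using sets by (intro guarded_embedding_between) (auto simp: C_def D_def)
  next
    fix n u v assume "set u \<subseteq> {..<a}" "game_equiv 1 m (Suc n) u v"
    then have "game_equiv 1 m n u v" "set u \<subseteq> set (C n)" "set u \<subseteq> set (D n)"
      using sets by (auto intro: game_equiv_mono)
    from recurrent_contexts.game_equiv_sandwich[OF contexts this lengths]
    show "game_equiv 1 (m + 1) n (rev (C n) @ u @ D n) (rev (C n) @ v @ D n)" by simp
  qed (use sets in \<open>auto simp: between_def\<close>)
  then show ?thesis by simp
qed

lemma hard_sentence_pad:
  assumes "hard_sentence 1 m a \<phi>" "suc_free \<phi>"
  shows "hard_sentence 2 m (Suc a) (relativize (NLett a) \<phi>)"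
proof -
  have "hard_sentence 2 (m + 0) (Suc a) (relativize (NLett a) \<phi>)"
  proof (rule hard_sentence_relativize[OF assms, where F = "\<lambda>n. pad n a"])
    fix n w assume "set w \<subseteq> {..<a}"
    then show "guarded_embedding (NLett a) (anchor n) w (pad n a w)"
      by (intro guarded_embedding_pad) auto
    show "set (pad n a w) \<subseteq> {..<Suc a}"
      using set_pad_subset[of n a w] \<open>set w \<subseteq> {..<a}\<close> by auto
  next
    fix n and u v :: "nat list" assume "game_equiv 1 m (Suc n) u v"
    then show "game_equiv 2 (m + 0) n (pad n a u) (pad n a v)" by (simp add: game_equiv_pad)
  qed auto
  then show ?thesis by simp
qed

lemma ex_suc_free_hard_sentence: "\<exists>a \<phi>. suc_free \<phi> \<and> hard_sentence 1 m a \<phi>"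
proof (induction m)
  case 0
  show ?case using hard_sentence_two_positions by (intro exI conjI) auto
next
  case (Suc m)
  then obtain a \<phi> where "suc_free \<phi>" "hard_sentence 1 m a \<phi>" by blast
  moreover from this have "suc_free (relativize (between a (Suc a)) \<phi>)"
    by (intro suc_free_relativize) (simp_all add: between_def)
  ultimately show ?case using hard_sentence_between by blast
qed

lemma FO2m_iff: "\<phi> \<in> FO2m m \<longleftrightarrow> blocks \<phi> \<le> m"
  by (auto simp: FO2m_def FO2mn_def intro: bexI[of _ "max m (qdepth \<phi>)"])

lemma game_equiv_imp_not_separates:
  assumes equiv: "\<And>n. game_equiv 2 m n (U n) (V n)" and sentence: "sentence \<psi>" "\<psi> \<in> FO2m m"
  shows "\<not> separates \<psi> (range U) (range V)"
proof -
  let ?n = "qdepth \<psi>"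
  have "sat (U ?n) (\<lambda>_. 0) \<psi> \<longleftrightarrow> sat (V ?n) (\<lambda>_. 0) \<psi>"
    using equiv sentence by (intro game_equiv_sat_iff) (auto simp: FO2m_iff)
  then show ?thesis by (auto simp: separates_def)
qed

theorem theorem5p6:
  fixes m :: nat
  assumes "m \<ge> 1"
  shows "\<exists>(\<Sigma>::nat set) (\<phi>::nat fo2) K L.
           finite \<Sigma> \<and> sentence \<phi> \<and> \<phi> \<in> FO2m m \<and> letters \<phi> \<subseteq> \<Sigma> \<and>
           K \<subseteq> lists \<Sigma> \<and> L \<subseteq> lists \<Sigma> \<and>
           separates \<phi> K L \<and>
           (\<forall>\<psi>::nat fo2. sentence \<psi> \<and> \<psi> \<in> FO2m (m - 1) \<and> letters \<psi> \<subseteq> \<Sigma>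
                \<longrightarrow> \<not> separates \<psi> K L)"
proof -
  obtain a \<phi> where hard: "hard_sentence 2 (m - 1) a \<phi>"
    using ex_suc_free_hard_sentence hard_sentence_pad by blast
  then obtain U V where words: "\<And>n. set (U n) \<subseteq> {..<a} \<and> set (V n) \<subseteq> {..<a}"
    and equiv: "\<And>n. game_equiv 2 (m - 1) n (U n) (V n)"
    and sat: "\<And>n. sat (U n) (\<lambda>_. 0) \<phi> \<and> \<not> sat (V n) (\<lambda>_. 0) \<phi>"
    unfolding hard_sentence_def by metis
  show ?thesis
  proof (intro exI conjI allI impI)
    show "sentence \<phi>" "\<phi> \<in> FO2m m" "letters \<phi> \<subseteq> {..<a}"
      using hard assms by (auto simp: hard_sentence_def FO2m_iff)
    show "range U \<subseteq> lists {..<a}" "range V \<subseteq> lists {..<a}" using words by auto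
    show "separates \<phi> (range U) (range V)" using sat by (auto simp: separates_def)
    show "\<not> separates \<psi> (range U) (range V)"
      if "sentence \<psi> \<and> \<psi> \<in> FO2m (m - 1) \<and> letters \<psi> \<subseteq> {..<a}" for \<psi>
      using equiv that by (intro game_equiv_imp_not_separates) auto
  qed simp
qed

end
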